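(* A partition $\lambda$ has no diagonal blocks (i.e. $\kappa(\lambda)=0$) if and only if it is self-conjugate. Consequently, for every $n\ge 0$, if $E(n)$ and $O(n)$ denote the numbers of partitions of $n$ having even and odd pairing rank, respectively, then $$E(n)-O(n)=(-1)^n\,\#\{\lambda\vdash n:\kappa(\lambda)=0\}.$$
   Context: Diagonal blocks: let $\lambda$ be a partition with conjugate $\lambda'$ and Durfee size $d$ (the side of the largest square contained in the Young diagram of $\lambda$). Put $\alpha_i=\lambda_i-d$, $\beta_i=\lambda_i'-d$, $I_i=\min(\alpha_i,\beta_i)$ and $U_i=\max(\alpha_i,\beta_i)$ for $1\le i\le d$. The diagonal blocks of $\lambda$ are the edge-connected components of the skew diagram $U/I$ (cells adjacent when they share an edge), and $\kappa(\lambda)$ is their number. Pairing rank: for a partition $\lambda$, let $r(\lambda)$ be the largest part size of multiplicity at least $2$ ($r(\lambda)=0$ if $\lambda$ has distinct parts). Let $u_1>u_2>\cdots$ be the part sizes occurring with odd multiplicity, each taken once, and let $s(\lambda)=u_1-u_2+u_3-u_4+\cdots$ ($0$ if there are none). The pairing rank is $\rho(\lambda)=r(\lambda)-s(\lambda)$. *)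

theory Defs
  imports Complex_Main
begin

definition is_partition :: "nat list \<Rightarrow> bool" where
  "is_partition xs \<longleftrightarrow> sorted_wrt (\<ge>) xs \<and> 0 \<notin> set xs"

definition partitions_of :: "nat \<Rightarrow> nat list set" where
  "partitions_of n = {xs. is_partition xs \<and> sum_list xs = n}"

(* 1-based indexing; part xs i = 0 beyond the length, and the junk value at i = 0 is never used. *)
definition part :: "nat list \<Rightarrow> nat \<Rightarrow> nat" where
  "part xs i = (if 1 \<le> i \<and> i \<le> length xs then xs ! (i - 1) else 0)"

(* Insensitive to trailing zeros in xs. *)
definition young_diagram :: "nat list \<Rightarrow> (nat \<times> nat) set" where
  "young_diagram xs = {(i, j). 1 \<le> i \<and> 1 \<le> j \<and> j \<le> part xs i}"

definition conjugate :: "nat list \<Rightarrow> nat list" where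
  "conjugate xs = map (\<lambda>j. card {i. (i, j) \<in> young_diagram xs}) [1..<Suc (part xs 1)]"

definition durfee :: "nat list \<Rightarrow> nat" where
  "durfee xs = (GREATEST d. {1..d} \<times> {1..d} \<subseteq> young_diagram xs)"

(* arm and leg are used only for 1 \<le> i \<le> durfee xs, where the nat subtractions do not truncate. *)
definition arm :: "nat list \<Rightarrow> nat \<Rightarrow> nat" where
  "arm xs i = part xs i - durfee xs"

definition leg :: "nat list \<Rightarrow> nat \<Rightarrow> nat" where
  "leg xs i = part (conjugate xs) i - durfee xs"

(* These two lists have length durfee xs and may end in zeros. *)
definition inner_shape :: "nat list \<Rightarrow> nat list" where
  "inner_shape xs = map (\<lambda>i. min (arm xs i) (leg xs i)) [1..<Suc (durfee xs)]"

definition outer_shape :: "nat list \<Rightarrow> nat list" where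
  "outer_shape xs = map (\<lambda>i. max (arm xs i) (leg xs i)) [1..<Suc (durfee xs)]"

definition skew_diagram :: "nat list \<Rightarrow> nat list \<Rightarrow> (nat \<times> nat) set" where
  "skew_diagram us vs = young_diagram us - young_diagram vs"

definition edge_adjacent :: "nat \<times> nat \<Rightarrow> nat \<times> nat \<Rightarrow> bool" where
  "edge_adjacent c c' \<longleftrightarrow>
     (fst c = fst c' \<and> (snd c = Suc (snd c') \<or> snd c' = Suc (snd c))) \<or>
     (snd c = snd c' \<and> (fst c = Suc (fst c') \<or> fst c' = Suc (fst c)))"

definition edge_components :: "(nat \<times> nat) set \<Rightarrow> (nat \<times> nat) set set" where
  "edge_components S = S // {(c, c'). c \<in> S \<and> c' \<in> S \<and> edge_adjacent c c'}\<^sup>*"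

definition diagonal_blocks :: "nat list \<Rightarrow> (nat \<times> nat) set set" where
  "diagonal_blocks xs = edge_components (skew_diagram (outer_shape xs) (inner_shape xs))"

definition kappa :: "nat list \<Rightarrow> nat" where
  "kappa xs = card (diagonal_blocks xs)"

definition largest_repeated :: "nat list \<Rightarrow> nat" where
  "largest_repeated xs = Max (insert 0 {p \<in> set xs. count_list xs p \<ge> 2})"

definition odd_mult_parts :: "nat list \<Rightarrow> nat list" where
  "odd_mult_parts xs = rev (sorted_list_of_set {p \<in> set xs. odd (count_list xs p)})"

(* The list index is 0-based, so the largest odd-multiplicity part gets the sign +. *)
definition alternating_odd_sum :: "nat list \<Rightarrow> int" where
  "alternating_odd_sum xs = (\<Sum>i<length (odd_mult_parts xs). (-1) ^ i * int (odd_mult_parts xs ! i))"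

definition pairing_rank :: "nat list \<Rightarrow> int" where
  "pairing_rank xs = int (largest_repeated xs) - alternating_odd_sum xs"

end

(* The alternating sum s is congruent mod 2 to the sum of the parts of odd multiplicity, hence to n,
   so (-1)^rho = (-1)^n (-1)^r.  Writing the multiset of parts as M + M + D with D a set, r is the
   largest part of M; conjugating M replaces (-1)^r by (-1)^(number of parts of M).  Regard the
   pair as the union of 2M (even parts) and D (distinct parts): moving the largest even part from
   one component to the other reverses the sign, and the fixed points are the pairs with M empty
   and D consisting of odd numbers.  These sets are the diagonal hook lengths of the self-conjugate
   partitions of n. *)
theory Submission
  imports Defs "HOL-Library.Multiset"
begin

section \<open>Conjugation and diagonal blocks\<close>

(* Multiset also has a fact part_def (for quicksort), hence the qualified Defs.part_def. *)

lemma part_antimono: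
  assumes "is_partition xs" "1 \<le> i" "i \<le> j"
  shows "part xs j \<le> part xs i"
proof (cases "i = j")
  case False
  then show ?thesis
    using assms by (auto simp: Defs.part_def is_partition_def sorted_wrt_iff_nth_less)
qed simp

lemma part_pos_iff:
  assumes "is_partition xs" "1 \<le> i"
  shows "1 \<le> part xs i \<longleftrightarrow> i \<le> length xs"
proof -
  have "xs ! (i - 1) \<noteq> 0" if "i \<le> length xs"
  proof -
    have "xs ! (i - 1) \<in> set xs" using assms that by simp
    then show ?thesis using assms by (metis is_partition_def)
  qed
  then show ?thesis using assms by (auto simp: Defs.part_def)
qed

lemma partition_eqI:
  assumes "is_partition xs" "is_partition ys" "\<And>i. 1 \<le> i \<Longrightarrow> part xs i = part ys i"
  shows "xs = ys"
proof (rule nth_equalityI)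
  have "i \<le> length xs \<longleftrightarrow> i \<le> length ys" if "1 \<le> i" for i
    using part_pos_iff[OF assms(1) that] part_pos_iff[OF assms(2) that] assms(3)[OF that] by simp
  from this[of "length xs"] this[of "length ys"] show len: "length xs = length ys"
    by (cases "length xs = 0"; cases "length ys = 0") auto
  fix i assume "i < length xs"
  then show "xs ! i = ys ! i" using assms(3)[of "Suc i"] len by (simp add: Defs.part_def)
qed

text \<open>Reduces equality of partitions to the comparisons \<open>j \<le> part xs i\<close>, that
  is to membership of cells; in this form conjugation just exchanges the two indices.\<close>

lemma partition_eqI_le:
  assumes "is_partition xs" "is_partition ys"
    "\<And>i j. 1 \<le> i \<Longrightarrow> 1 \<le> j \<Longrightarrow> j \<le> part xs i \<longleftrightarrow> j \<le> part ys i"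
  shows "xs = ys"
proof (rule partition_eqI[OF assms(1,2)])
  fix i :: nat assume i: "1 \<le> i"
  show "part xs i = part ys i"
    using assms(3)[OF i, of "part xs i"] assms(3)[OF i, of "part ys i"]
    by (cases "part xs i = 0"; cases "part ys i = 0") auto
qed

text \<open>Meant for the columns of a Young diagram: a column has no gaps, so its cell count is
  also its last row index.\<close>

lemma finite_down_closed_nat:
  fixes A :: "nat set"
  assumes "finite A" "0 \<notin> A" "\<And>i j. j \<in> A \<Longrightarrow> 1 \<le> i \<Longrightarrow> i \<le> j \<Longrightarrow> i \<in> A"
  shows "A = {1..card A}"
proof (cases "A = {}")
  case False
  have "A = {1..Max A}"
  proof
    show "A \<subseteq> {1..Max A}" using assms(1,2) by (auto simp: Suc_le_eq intro: gr0I)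
    show "{1..Max A} \<subseteq> A" using assms(3) Max_in[OF assms(1) False] by auto
  qed
  then show ?thesis by (metis card_atLeastAtMost diff_Suc_1 One_nat_def)
qed simp

text \<open>This is the working form of conjugation, through which the list definition is mostly
  bypassed. Parts decrease, so column j is an initial segment of rows and counting its cells gives
  its depth. For j beyond the first part, both sides fail because \<open>part\<close> is 0 past the
  end of a list.\<close>

lemma part_conjugate_iff:
  assumes "is_partition xs" "1 \<le> i" "1 \<le> j"
  shows "i \<le> part (conjugate xs) j \<longleftrightarrow> j \<le> part xs i"
proof (cases "j \<le> part xs 1")
  case True
  define A where "A = {i. (i, j) \<in> young_diagram xs}"
  have mem: "i \<in> A \<longleftrightarrow> 1 \<le> i \<and> j \<le> part xs i" for i
    using assms(3) by (auto simp: A_def young_diagram_def)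
  have "A \<subseteq> {..length xs}" using assms(3) by (auto simp: mem Defs.part_def split: if_splits)
  then have "finite A" by (rule finite_subset) simp
  moreover have "i \<in> A" if "k \<in> A" "1 \<le> i" "i \<le> k" for i k
    using that part_antimono[OF assms(1), of i k] by (auto simp: mem)
  ultimately have A: "A = {1..card A}"
    using finite_down_closed_nat[of A] mem by auto
  have "[Suc 0..<Suc (part xs (Suc 0))] ! (j - Suc 0) = j"
    using True assms(3) by (subst nth_upt) auto
  then have "part (conjugate xs) j = card A"
    using True assms(3) by (simp add: Defs.part_def[of _ j] conjugate_def A_def del: upt_Suc)
  then show ?thesis using A mem[of i] assms(2) by (metis atLeastAtMost_iff)
next
  case False
  have "part (conjugate xs) j = 0"
    using False by (simp add: Defs.part_def[of _ j] conjugate_def del: upt_Suc)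
  then show ?thesis using assms False part_antimono[OF assms(1), of 1 i] by auto
qed

lemma length_conjugate: "length (conjugate xs) = part xs 1"
  by (simp add: conjugate_def del: upt_Suc)

text \<open>Serves lists such as \<open>conjugate xs\<close> and \<open>add_hook k ys\<close>, which
  are understood through their parts rather than their entries.\<close>

lemma is_partition_iff_part:
  "is_partition xs \<longleftrightarrow> (\<forall>i. 1 \<le> i \<and> i \<le> length xs \<longrightarrow> 1 \<le> part xs i) \<and>
     (\<forall>i j. 1 \<le> i \<and> i \<le> j \<longrightarrow> part xs j \<le> part xs i)"  (is "_ \<longleftrightarrow> ?R")
proof
  assume "is_partition xs"
  then show ?R using part_antimono part_pos_iff by blast
next
  assume R: ?R
  have "xs ! j \<le> xs ! i" if "i < j" "j < length xs" for i j
    using R[THEN conjunct2, rule_format, of "Suc i" "Suc j"] that by (simp add: Defs.part_def)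
  moreover have "xs ! i \<noteq> 0" if "i < length xs" for i
    using R[THEN conjunct1, rule_format, of "Suc i"] that by (simp add: Defs.part_def)
  ultimately show "is_partition xs"
    by (auto simp: is_partition_def sorted_wrt_iff_nth_less in_set_conv_nth)
qed

lemma is_partition_conjugate:
  assumes "is_partition xs"
  shows "is_partition (conjugate xs)"
proof -
  \<comment> \<open>The bottom cell of column j lies in the diagram; moving left along its row
    reaches column i, which is therefore at least as deep.\<close>
  have "part (conjugate xs) j \<le> part (conjugate xs) i" if "1 \<le> i" "i \<le> j" for i j
    using that part_conjugate_iff[OF assms, of "part (conjugate xs) j" i]
      part_conjugate_iff[OF assms, of "part (conjugate xs) j" j]
    by (cases "part (conjugate xs) j = 0") auto
  moreover have "1 \<le> part (conjugate xs) i" if "1 \<le> i" "i \<le> length (conjugate xs)" for i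
    using that part_conjugate_iff[OF assms, of 1 i] by (simp add: length_conjugate)
  ultimately show ?thesis by (auto simp: is_partition_iff_part)
qed

lemma conjugate_eq_iff:
  assumes "is_partition xs" "is_partition ys"
  shows "conjugate xs = ys \<longleftrightarrow> (\<forall>i j. 1 \<le> i \<longrightarrow> 1 \<le> j \<longrightarrow> (i \<le> part xs j \<longleftrightarrow> j \<le> part ys i))"
  using partition_eqI_le[OF is_partition_conjugate[OF assms(1)] assms(2)]
    part_conjugate_iff[OF assms(1)] by blast

lemma conjugate_conjugate:
  assumes "is_partition xs"
  shows "conjugate (conjugate xs) = xs"
  using assms by (simp add: conjugate_eq_iff is_partition_conjugate part_conjugate_iff)

lemma young_diagram_conjugate:
  assumes "is_partition xs"
  shows "young_diagram (conjugate xs) = prod.swap ` young_diagram xs"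
  using part_conjugate_iff[OF assms] by (auto simp: young_diagram_def image_iff)

lemma young_diagram_Sigma:
  "young_diagram xs = (SIGMA i:{1..length xs}. {1..part xs i})"
  by (auto simp: young_diagram_def Defs.part_def split: if_splits)

lemma finite_young_diagram: "finite (young_diagram xs)"
  by (simp add: young_diagram_Sigma)

lemma card_young_diagram: "card (young_diagram xs) = sum_list xs"
proof -
  have "card (young_diagram xs) = (\<Sum>i=1..length xs. part xs i)"
    by (simp add: young_diagram_Sigma)
  also have "\<dots> = (\<Sum>i<length xs. xs ! i)"
    by (rule sum.reindex_bij_witness[of _ Suc "\<lambda>i. i - 1"]) (auto simp: Defs.part_def)
  finally show ?thesis by (simp add: sum_list_sum_nth atLeast0LessThan)
qed

lemma sum_list_conjugate:
  assumes "is_partition xs"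
  shows "sum_list (conjugate xs) = sum_list xs"
  unfolding card_young_diagram[symmetric] young_diagram_conjugate[OF assms]
  by (rule card_image) simp

section \<open>The Durfee square\<close>

lemma durfee_square: "{1..durfee xs} \<times> {1..durfee xs} \<subseteq> young_diagram xs"
  and durfee_greatest: "{1..d} \<times> {1..d} \<subseteq> young_diagram xs \<Longrightarrow> d \<le> durfee xs"
proof -
  let ?P = "\<lambda>d. {1..d} \<times> {1..d} \<subseteq> young_diagram xs"
  \<comment> \<open>\<open>GREATEST\<close> is meaningful only with an upper bound; the corner cell
    (d, d) of the square provides one.\<close>
  have bound: "d \<le> length xs" if "?P d" for d
  proof (cases "d = 0")
    case False
    then have "(d, d) \<in> young_diagram xs" using that by auto
    then show ?thesis by (simp add: young_diagram_Sigma)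
  qed simp
  show "?P (durfee xs)" unfolding durfee_def
    by (rule GreatestI_nat[of ?P 0 "length xs"]) (use bound in auto)
  show "d \<le> durfee xs" if "?P d"
    unfolding durfee_def by (rule Greatest_le_nat[of ?P d "length xs"]) (use bound that in auto)
qed

lemma durfee_le_part: "1 \<le> i \<Longrightarrow> i \<le> durfee xs \<Longrightarrow> durfee xs \<le> part xs i"
  using subsetD[OF durfee_square, of "(i, durfee xs)" xs] by (auto simp: young_diagram_def)

text \<open>A longer row below the Durfee square would make the first d + 1 rows all at least d + 1
  long, giving a larger square.\<close>

lemma part_le_durfee:
  assumes "is_partition xs" "durfee xs < i"
  shows "part xs i \<le> durfee xs"
proof (rule ccontr)
  assume "\<not> ?thesis"
  then have *: "Suc (durfee xs) \<le> part xs i" by simp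
  have "Suc (durfee xs) \<le> part xs k" if "1 \<le> k" "k \<le> Suc (durfee xs)" for k
    using part_antimono[OF assms(1), of k i] * that assms(2) by linarith
  then have "Suc (durfee xs) \<le> durfee xs"
    by (intro durfee_greatest) (fastforce simp: young_diagram_def)
  then show False by simp
qed

section \<open>Partitions without diagonal blocks\<close>

lemma finite_edge_components: "finite S \<Longrightarrow> finite (edge_components S)"
  by (simp add: edge_components_def quotient_def)

text \<open>Every cell lies in some component, so there are no components exactly when the skew
  diagram is empty. Comparing row ends, this says that the maximum of arm and leg is at most their
  minimum.\<close>

lemma kappa_eq_0_iff:
  "kappa xs = 0 \<longleftrightarrow> (\<forall>i. 1 \<le> i \<and> i \<le> durfee xs \<longrightarrow> arm xs i = leg xs i)"
proof -
  \<comment> \<open>Finiteness excludes the default value 0 of \<open>card\<close> on infinite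
    sets.\<close>
  have "finite (skew_diagram (outer_shape xs) (inner_shape xs))"
    by (simp add: skew_diagram_def finite_young_diagram)
  then have "kappa xs = 0 \<longleftrightarrow> young_diagram (outer_shape xs) \<subseteq> young_diagram (inner_shape xs)"
    unfolding kappa_def diagonal_blocks_def
    by (auto simp: finite_edge_components) (auto simp: edge_components_def quotient_def skew_diagram_def)
  also have "\<dots> \<longleftrightarrow> (\<forall>i\<ge>1. part (outer_shape xs) i \<le> part (inner_shape xs) i)" (is "?L \<longleftrightarrow> ?R")
  proof
    assume L: ?L
    show ?R
    proof (intro allI impI)
      fix i :: nat assume "1 \<le> i"
      then show "part (outer_shape xs) i \<le> part (inner_shape xs) i"
        using subsetD[OF L, of "(i, part (outer_shape xs) i)"]
        by (cases "part (outer_shape xs) i = 0") (auto simp: young_diagram_def)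
    qed
  qed (auto simp: young_diagram_def intro: order_trans)
  also have "\<dots> \<longleftrightarrow> (\<forall>i. 1 \<le> i \<and> i \<le> durfee xs \<longrightarrow>
      max (arm xs i) (leg xs i) \<le> min (arm xs i) (leg xs i))"
    by (auto simp: Defs.part_def outer_shape_def inner_shape_def nth_upt simp del: upt_Suc)
  also have "\<dots> \<longleftrightarrow> (\<forall>i. 1 \<le> i \<and> i \<le> durfee xs \<longrightarrow> arm xs i = leg xs i)"
    by (auto intro!: antisym)
  finally show ?thesis .
qed

text \<open>A cell in one of the first d rows or columns is reflected into the diagram because these
  rows and columns have equal lengths. No cell has both coordinates larger than d.\<close>

lemma kappa_eq_0_iff_self_conjugate:
  assumes "is_partition xs"
  shows "kappa xs = 0 \<longleftrightarrow> conjugate xs = xs"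
proof
  let ?d = "durfee xs"
  note conj = part_conjugate_iff[OF assms]
  assume "kappa xs = 0"
  then have al: "arm xs i = leg xs i" if "1 \<le> i" "i \<le> ?d" for i
    using that by (simp add: kappa_eq_0_iff)
  \<comment> \<open>Both parts are at least d, so the truncated differences \<open>arm\<close> and
    \<open>leg\<close> determine them.\<close>
  have small: "part (conjugate xs) i = part xs i" if i: "1 \<le> i" "i \<le> ?d" for i
    using al[OF i] durfee_le_part[OF i] conj[of ?d i] durfee_le_part[of ?d xs] i
    by (auto simp: arm_def leg_def)
  show "conjugate xs = xs"
    unfolding conjugate_eq_iff[OF assms assms]
  proof (intro allI impI)
    fix i j :: nat assume ij: "1 \<le> i" "1 \<le> j"
    show "i \<le> part xs j \<longleftrightarrow> j \<le> part xs i"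
    proof (cases "i \<le> ?d \<or> j \<le> ?d")
      case True
      then show ?thesis using small[of i] small[of j] conj[of i j] conj[of j i] ij by auto
    next
      case False
      then show ?thesis using part_le_durfee[OF assms, of i] part_le_durfee[OF assms, of j] by auto
    qed
  qed
qed (simp add: kappa_eq_0_iff arm_def leg_def)

section \<open>Self-conjugate partitions and diagonal hooks\<close>

(* Adds a first row and a first column of length k around the diagram of ys. *)
definition add_hook :: "nat \<Rightarrow> nat list \<Rightarrow> nat list" where
  "add_hook k ys = k # map Suc ys @ replicate (k - 1 - length ys) 1"

definition self_conjugate :: "nat list \<Rightarrow> bool" where
  "self_conjugate xs \<longleftrightarrow> is_partition xs \<and> conjugate xs = xs"

(* The recursive call removes the first row and the first column of the diagram. *)
function diagonal_hooks :: "nat list \<Rightarrow> nat set" where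
  "diagonal_hooks [] = {}"
| "diagonal_hooks (k # xs) =
     insert (2 * k - 1) (diagonal_hooks (map (\<lambda>x. x - 1) (filter (\<lambda>x. 1 < x) xs)))"
  by pat_completeness auto
termination
  by (relation "measure length") (auto simp: le_imp_less_Suc)

section \<open>Adding and peeling off a hook\<close>

lemma length_add_hook: "length ys < k \<Longrightarrow> length (add_hook k ys) = k"
  by (simp add: add_hook_def)

lemma sum_list_Suc: "sum_list (map Suc xs) = sum_list xs + length xs"
  by (induction xs) auto

text \<open>The new row and the new column have k cells each and share the corner.\<close>

lemma sum_list_add_hook: "length ys < k \<Longrightarrow> sum_list (add_hook k ys) = 2 * k - 1 + sum_list ys"
  by (simp add: add_hook_def sum_list_Suc sum_list_replicate)

text \<open>The parts of \<open>ys\<close> are positive, so their successors survive the filter,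
  while the padding ones are dropped: the recursive call recovers exactly \<open>ys\<close>.\<close>

lemma diagonal_hooks_add_hook:
  assumes "is_partition ys"
  shows "diagonal_hooks (add_hook k ys) = insert (2 * k - 1) (diagonal_hooks ys)"
proof -
  have "filter (\<lambda>x. 1 < x) (map Suc ys) = map Suc ys"
    using assms by (auto simp: filter_id_conv is_partition_def intro: gr0I)
  then show ?thesis by (simp add: add_hook_def comp_def)
qed

lemma part_add_hook:
  assumes "length ys < k" "1 \<le> i"
  shows "part (add_hook k ys) i =
    (if i = 1 then k else if i \<le> k then Suc (part ys (i - 1)) else 0)"
proof (cases i)
  case (Suc j)
  then show ?thesis using assms
    by (auto simp: Defs.part_def add_hook_def nth_append nth_Cons')
qed (use assms in simp)

text \<open>The converse implication arises by exchanging i and j.\<close>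

lemma self_conjugate_iff:
  assumes "is_partition xs"
  shows "self_conjugate xs \<longleftrightarrow> (\<forall>i j. 1 \<le> i \<longrightarrow> 1 \<le> j \<longrightarrow> i \<le> part xs j \<longrightarrow> j \<le> part xs i)"
  using assms by (auto simp: self_conjugate_def conjugate_eq_iff)

lemma self_conjugate_part_1:
  assumes "self_conjugate xs"
  shows "part xs 1 = length xs"
  using assms length_conjugate[of xs] by (simp add: self_conjugate_def)

lemma part_beyond: "length xs < i \<Longrightarrow> part xs i = 0"
  by (simp add: Defs.part_def)

text \<open>The frame of length k is symmetric, and inside it the symmetric diagram of
  \<open>ys\<close> is shifted one step along the diagonal.\<close>

lemma self_conjugate_add_hook:
  assumes ys: "self_conjugate ys" and k: "length ys < k"
  shows "self_conjugate (add_hook k ys)"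
proof -
  have p: "is_partition ys" using ys by (simp add: self_conjugate_def)
  \<comment> \<open>By symmetry the first part of \<open>ys\<close> is its length, so the new first
    row is at least as long as every row below it.\<close>
  have le: "part ys i < k" if "1 \<le> i" for i
    using part_antimono[OF p _ that] self_conjugate_part_1[OF ys] k by simp
  have "is_partition (add_hook k ys)"
    unfolding is_partition_iff_part
  proof (intro conjI allI impI; elim conjE)
    fix i j :: nat assume ij: "1 \<le> i" "i \<le> j"
    consider "j = 1" | "i = 1" "2 \<le> j" | "2 \<le> i" "2 \<le> j" using ij by linarith
    then show "part (add_hook k ys) j \<le> part (add_hook k ys) i"
    proof cases
      case 2
      then show ?thesis using le[of "j - 1"] k
        by (auto simp: part_add_hook intro!: Suc_leI)
    next
      case 3
      then show ?thesis
        using ij part_antimono[OF p, of "i - 1" "j - 1"] k by (simp add: part_add_hook)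
    qed (use ij in simp)
  qed (use k in \<open>auto simp: part_add_hook length_add_hook\<close>)
  moreover have "j \<le> part (add_hook k ys) i"
    if ij: "1 \<le> i" "1 \<le> j" "i \<le> part (add_hook k ys) j" for i j
  proof (cases "i = 1 \<or> j = 1")
    case True
    then show ?thesis using ij k by (auto simp: part_add_hook split: if_splits)
  next
    case False
    then have "i - 1 \<le> part ys (j - 1)" "j \<le> k" "2 \<le> i" "2 \<le> j"
      using ij k by (auto simp: part_add_hook split: if_splits)
    moreover from this have "j - 1 \<le> part ys (i - 1)"
      using ys self_conjugate_iff[OF p] by simp
    moreover have "part ys (j - 1) < k" using le[of "j - 1"] \<open>2 \<le> j\<close> by simp
    then have "i \<le> k" using \<open>i - 1 \<le> part ys (j - 1)\<close> by linarith
    ultimately show ?thesis using k by (simp add: part_add_hook)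
  qed
  ultimately show ?thesis by (simp add: self_conjugate_iff)
qed

lemma self_conjugate_Nil: "self_conjugate []"
  by (simp add: self_conjugate_def is_partition_def conjugate_def Defs.part_def)

text \<open>Peels off the first row and the first column, which have the same length k by symmetry;
  what remains is again symmetric.\<close>

lemma self_conjugate_cases:
  assumes xs: "self_conjugate xs" and "xs \<noteq> []"
  obtains k ys where "xs = add_hook k ys" "self_conjugate ys" "length ys < k"
proof -
  have p: "is_partition xs" using xs by (simp add: self_conjugate_def)
  define k where "k = length xs"
  have k: "part xs 1 = k" "k \<ge> 1" using self_conjugate_part_1[OF xs] assms(2)
    by (auto simp: k_def Suc_le_eq)
  define ys where "ys = map (\<lambda>x. x - 1) (filter (\<lambda>x. 1 < x) (tl xs))"
  obtain zs where zs: "xs = k # zs"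
    using assms(2) k(1) by (cases xs) (auto simp: Defs.part_def)
  \<comment> \<open>In a decreasing list of positive numbers the ones come last, so they can be
    filtered out and restored by padding at the end.\<close>
  have eq: "zs = map Suc (map (\<lambda>x. x - 1) (filter (\<lambda>x. 1 < x) zs)) @
      replicate (length zs - length (filter (\<lambda>x. 1 < x) zs)) 1"
    if "sorted_wrt (\<ge>) zs" "0 \<notin> set zs" for zs :: "nat list"
    using that
  proof (induction zs)
    case (Cons z zs)
    show ?case
    proof (cases "1 < z")
      case False
      moreover have "x = 1" if "x \<in> set zs" for x
      proof -
        have "x \<le> z" using Cons.prems that by auto
        moreover have "x \<noteq> 0" using Cons.prems(2) that by (metis list.set_intros(2))
        ultimately show ?thesis using False by simp
      qed
      ultimately have "z = 1" "\<forall>x\<in>set zs. x = 1" using Cons.prems by auto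
      moreover from this have "replicate (length zs) 1 = zs" by (simp add: replicate_length_same)
      moreover have "filter (\<lambda>x. 1 < x) zs = []" using calculation by (simp add: filter_empty_conv)
      ultimately show ?thesis by simp
    qed (use Cons in auto)
  qed simp
  have len: "length zs = k - 1" using zs k_def by (metis length_tl list.sel(3))
  have ysz: "ys = map (\<lambda>x. x - 1) (filter (\<lambda>x. 1 < x) zs)" by (simp add: ys_def zs)
  have xs_eq: "xs = add_hook k ys"
    using eq[of zs] p unfolding zs add_hook_def ysz
    by (simp add: is_partition_def len)
  have "length ys \<le> length zs" by (simp add: ysz)
  then have lk: "length ys < k" using len k(2) by simp
  have "0 \<notin> set ys" by (auto simp: ysz)
  moreover have "sorted_wrt (\<ge>) zs" using p by (simp add: zs is_partition_def)
  then have "sorted_wrt (\<ge>) ys" unfolding ysz sorted_wrt_map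
    by (intro sorted_wrt_mono_rel[OF _ sorted_wrt_filter]) auto
  ultimately have py: "is_partition ys" by (simp add: is_partition_def)
  have "j \<le> part ys i" if ij: "1 \<le> i" "1 \<le> j" "i \<le> part ys j" for i j
  proof -
    \<comment> \<open>A row j of \<open>ys\<close> that has a cell satisfies j \<le>
      \<open>length ys\<close>, so row j + 1 still lies in the frame and the cell can be shifted
      into \<open>xs\<close>.\<close>
    have "j < k" using part_beyond[of ys j] ij lk by (cases "j < k") auto
    then have "Suc i \<le> part xs (Suc j)"
      using ij lk by (simp add: xs_eq part_add_hook)
    then have "Suc j \<le> part xs (Suc i)"
      using xs self_conjugate_iff[OF p] by simp
    then show ?thesis using ij lk by (simp add: xs_eq part_add_hook split: if_splits)
  qed
  then have "self_conjugate ys" using self_conjugate_iff[OF py] by blast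
  then show ?thesis using that xs_eq lk by blast
qed

lemma self_conjugate_induct [consumes 1, case_names Nil add_hook]:
  assumes "self_conjugate xs" "P []"
    "\<And>k ys. self_conjugate ys \<Longrightarrow> length ys < k \<Longrightarrow> P ys \<Longrightarrow> P (add_hook k ys)"
  shows "P xs"
  using assms(1)
proof (induction xs rule: length_induct)
  case (1 xs)
  show ?case
  proof (cases "xs = []")
    case False
    then obtain k ys where "xs = add_hook k ys" "self_conjugate ys" "length ys < k"
      using self_conjugate_cases 1(2) by blast
    then show ?thesis using 1(1) assms(3)[of ys k] by (simp add: length_add_hook)
  qed (simp add: assms(2))
qed

text \<open>The bound on h drives the induction: all hooks of \<open>ys\<close> are below 2 *
  \<open>length ys\<close>, so 2k - 1 is a new element and the sum over the set loses
  nothing.\<close>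

lemma diagonal_hooks_self_conjugate:
  assumes "self_conjugate xs"
  shows "finite (diagonal_hooks xs) \<and>
    (\<forall>h\<in>diagonal_hooks xs. odd h \<and> h < 2 * length xs) \<and>
    \<Sum>(diagonal_hooks xs) = sum_list xs"
  using assms
proof (induction rule: self_conjugate_induct)
  case (add_hook k ys)
  have IH: "finite (diagonal_hooks ys)" "\<And>h. h \<in> diagonal_hooks ys \<Longrightarrow> odd h"
    "\<And>h. h \<in> diagonal_hooks ys \<Longrightarrow> h < 2 * length ys" "\<Sum>(diagonal_hooks ys) = sum_list ys"
    using add_hook.IH by blast+
  have *: "diagonal_hooks (add_hook k ys) = insert (2 * k - 1) (diagonal_hooks ys)"
    using add_hook.hyps(1) by (simp add: diagonal_hooks_add_hook self_conjugate_def)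
  have "2 * k - 1 \<notin> diagonal_hooks ys" using IH(3)[of "2 * k - 1"] add_hook.hyps(2) by linarith
  then have "\<Sum>(diagonal_hooks (add_hook k ys)) = sum_list (add_hook k ys)"
    using IH(1,4) add_hook.hyps(2) by (simp add: * sum_list_add_hook)
  moreover have "odd h \<and> h < 2 * length (add_hook k ys)" if "h \<in> diagonal_hooks (add_hook k ys)" for h
    using that IH(2,3)[of h] add_hook.hyps(2) by (fastforce simp: * length_add_hook)
  ultimately show ?case using IH(1) by (simp add: *)
qed simp

text \<open>The outermost hook is the maximum of the set, so k can be read off; deleting it leaves
  the hook set of the inner partition.\<close>

lemma diagonal_hooks_inj:
  assumes "self_conjugate xs" "self_conjugate ys" "diagonal_hooks xs = diagonal_hooks ys"
  shows "xs = ys"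
  using assms
proof (induction arbitrary: ys rule: self_conjugate_induct)
  case Nil
  have "ys = []"
  proof (rule ccontr)
    assume "ys \<noteq> []"
    then obtain k zs where "ys = add_hook k zs" "self_conjugate zs"
      using self_conjugate_cases Nil by blast
    then show False
      using Nil by (simp add: diagonal_hooks_add_hook self_conjugate_def)
  qed
  then show ?case by simp
next
  case (add_hook k xs)
  have hx: "diagonal_hooks (add_hook k xs) = insert (2 * k - 1) (diagonal_hooks xs)"
    using add_hook(1) by (simp add: diagonal_hooks_add_hook self_conjugate_def)
  then have "ys \<noteq> []" using add_hook.prems by auto
  then obtain l zs where zs: "ys = add_hook l zs" "self_conjugate zs" "length zs < l"
    using self_conjugate_cases add_hook.prems by blast
  have hy: "diagonal_hooks ys = insert (2 * l - 1) (diagonal_hooks zs)"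
    using zs by (simp add: diagonal_hooks_add_hook self_conjugate_def)
  have bx: "h < 2 * k - 1" if "h \<in> diagonal_hooks xs" for h
    using diagonal_hooks_self_conjugate[OF add_hook(1)] add_hook(2) that by fastforce
  have by': "h < 2 * l - 1" if "h \<in> diagonal_hooks zs" for h
    using diagonal_hooks_self_conjugate[OF zs(2)] zs(3) that by fastforce
  have eq: "insert (2 * k - 1) (diagonal_hooks xs) = insert (2 * l - 1) (diagonal_hooks zs)"
    using hx hy add_hook.prems by simp
  have "2 * k - 1 \<le> 2 * l - 1"
    using equalityD1[OF eq] by' by (force simp: less_imp_le)
  moreover have "2 * l - 1 \<le> 2 * k - 1"
    using equalityD2[OF eq] bx by (force simp: less_imp_le)
  ultimately have kl: "k = l" using add_hook.hyps(2) zs(3) by linarith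
  have "2 * l - 1 \<notin> diagonal_hooks xs" "2 * l - 1 \<notin> diagonal_hooks zs"
    using bx by' kl by blast+
  then have "diagonal_hooks xs = diagonal_hooks zs"
    using eq kl by (simp add: insert_ident)
  then have "xs = zs" using add_hook.IH zs(2) by blast
  then show ?case using zs(1) kl by simp
qed

text \<open>Builds the partition from the inside outwards, wrapping the hooks in increasing order of
  length.\<close>

lemma diagonal_hooks_surj:
  assumes "finite D" "\<forall>h\<in>D. odd h"
  shows "\<exists>xs. self_conjugate xs \<and> diagonal_hooks xs = D"
  using assms
proof (induction D rule: finite_linorder_max_induct)
  case empty
  then show ?case using self_conjugate_Nil by (intro exI[of _ "[]"]) simp
next
  case (insert h D)
  then obtain ys where ys: "self_conjugate ys" "diagonal_hooks ys = D"
    by auto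
  from insert.prems obtain m where h: "h = 2 * m + 1" by (auto elim: oddE)
  \<comment> \<open>The outermost hook of \<open>ys\<close> has length 2 * \<open>length ys\<close>
    - 1 and belongs to D, so it is smaller than h = 2(m + 1) - 1.\<close>
  have len: "length ys < Suc m"
  proof (cases "ys = []")
    case False
    then obtain k zs where "ys = add_hook k zs" "self_conjugate zs" "length zs < k"
      using self_conjugate_cases ys(1) by blast
    then have "2 * length ys - 1 \<in> D"
      using ys(2) by (auto simp: length_add_hook diagonal_hooks_add_hook self_conjugate_def)
    then show ?thesis using insert.hyps h by fastforce
  qed simp
  then have "diagonal_hooks (add_hook (Suc m) ys) = insert h D"
    using ys by (simp add: h diagonal_hooks_add_hook self_conjugate_def)
  then show ?case using self_conjugate_add_hook[OF ys(1) len] by blast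
qed

text \<open>The classical correspondence with partitions into distinct odd parts, the latter encoded
  as finite sets.\<close>

lemma card_self_conjugate_partitions:
  "card {xs \<in> partitions_of n. conjugate xs = xs} =
    card {D. finite D \<and> (\<forall>h\<in>D. odd h) \<and> \<Sum>D = n}"
proof (rule bij_betw_same_card, rule bij_betwI')
  fix xs ys assume "xs \<in> {xs \<in> partitions_of n. conjugate xs = xs}"
    "ys \<in> {xs \<in> partitions_of n. conjugate xs = xs}"
  then show "diagonal_hooks xs = diagonal_hooks ys \<longleftrightarrow> xs = ys"
    using diagonal_hooks_inj by (auto simp: partitions_of_def self_conjugate_def)
next
  fix xs assume "xs \<in> {xs \<in> partitions_of n. conjugate xs = xs}"
  then show "diagonal_hooks xs \<in> {D. finite D \<and> (\<forall>h\<in>D. odd h) \<and> \<Sum>D = n}"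
    using diagonal_hooks_self_conjugate[of xs] by (auto simp: partitions_of_def self_conjugate_def)
next
  fix D assume D: "D \<in> {D. finite D \<and> (\<forall>h\<in>D. odd h) \<and> \<Sum>D = (n::nat)}"
  then obtain xs where xs: "self_conjugate xs" "diagonal_hooks xs = D"
    using diagonal_hooks_surj[of D] by blast
  then show "\<exists>xs\<in>{xs \<in> partitions_of n. conjugate xs = xs}. D = diagonal_hooks xs"
    using diagonal_hooks_self_conjugate[OF xs(1)] D
    by (auto simp: partitions_of_def self_conjugate_def)
qed

section \<open>The signed count by pairing rank\<close>

lemma rev_sort_partition:
  assumes "is_partition xs"
  shows "rev (sort xs) = xs"
proof -
  have "sorted (rev xs)" using assms by (simp add: is_partition_def sorted_wrt_rev)
  then have "sort xs = rev xs" by (intro properties_for_sort) simp_all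
  then show ?thesis by simp
qed

lemma is_partition_rev_sorted_list_of_multiset:
  "0 \<notin># M \<Longrightarrow> is_partition (rev (sorted_list_of_multiset M))"
  by (simp add: is_partition_def sorted_wrt_rev)

lemma bij_betw_mset_partitions:
  "bij_betw mset (partitions_of n) {M. 0 \<notin># M \<and> sum_mset M = n}"
proof (rule bij_betw_byWitness[where f' = "\<lambda>M. rev (sorted_list_of_multiset M)"])
  show "\<forall>xs\<in>partitions_of n. rev (sorted_list_of_multiset (mset xs)) = xs"
    by (auto simp: partitions_of_def rev_sort_partition)
  show "mset ` partitions_of n \<subseteq> {M. 0 \<notin># M \<and> sum_mset M = n}"
    by (auto simp: partitions_of_def is_partition_def sum_mset_sum_list)
  show "(\<lambda>M. rev (sorted_list_of_multiset M)) ` {M. 0 \<notin># M \<and> sum_mset M = n} \<subseteq> partitions_of n"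
  proof clarify
    fix M :: "nat multiset" assume M: "0 \<notin># M" "n = sum_mset M"
    have "sum_list (rev (sorted_list_of_multiset M)) = sum_mset M"
      by (metis mset_rev mset_sorted_list_of_multiset sum_mset_sum_list)
    then show "rev (sorted_list_of_multiset M) \<in> partitions_of (sum_mset M)"
      using M by (simp add: partitions_of_def is_partition_rev_sorted_list_of_multiset)
  qed
qed simp

lemma finite_partitions_of: "finite (partitions_of n)"
proof (rule finite_subset)
  show "partitions_of n \<subseteq> {xs. set xs \<subseteq> {..n} \<and> length xs \<le> n}"
  proof clarify
    fix xs assume "xs \<in> partitions_of n"
    then have xs: "0 \<notin> set xs" "sum_list xs = n" by (auto simp: partitions_of_def is_partition_def)
    have "length xs \<le> sum_list xs" if "0 \<notin> set xs" for xs :: "nat list"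
      using that by (induction xs) auto
    then show "set xs \<subseteq> {..n} \<and> length xs \<le> n"
      using xs member_le_sum_list by fastforce
  qed
qed (simp add: finite_lists_length_le)

lemma part_1_eq_Max:
  assumes "is_partition xs"
  shows "part xs 1 = Max (insert 0 (set xs))"
proof (cases xs)
  case (Cons x ys)
  then have "Max (insert 0 (set xs)) = x"
    using assms by (intro Max_eqI) (auto simp: is_partition_def)
  then show ?thesis by (simp add: Cons Defs.part_def)
qed (simp add: Defs.part_def)

definition conjugate_mset :: "nat multiset \<Rightarrow> nat multiset" where
  "conjugate_mset M = mset (conjugate (rev (sorted_list_of_multiset M)))"

text \<open>Transports to multisets a weight-preserving involution that exchanges the largest part
  and the number of parts. The inserted 0 is the largest part of the empty partition.\<close>

lemma conjugate_mset:
  assumes "0 \<notin># M"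
  shows "0 \<notin># conjugate_mset M" "sum_mset (conjugate_mset M) = sum_mset M"
    "conjugate_mset (conjugate_mset M) = M" "size (conjugate_mset M) = Max (insert 0 (set_mset M))"
proof -
  define xs where "xs = rev (sorted_list_of_multiset M)"
  have xs: "is_partition xs" "mset xs = M"
    using assms by (simp_all add: xs_def is_partition_rev_sorted_list_of_multiset)
  note p = is_partition_conjugate[OF xs(1)]
  have c: "conjugate_mset M = mset (conjugate xs)"
    by (simp add: conjugate_mset_def xs_def)
  show "0 \<notin># conjugate_mset M" using p by (simp add: c is_partition_def)
  show "sum_mset (conjugate_mset M) = sum_mset M"
    using sum_list_conjugate[OF xs(1)] xs(2) unfolding c by (metis sum_mset_sum_list)
  show "conjugate_mset (conjugate_mset M) = M"
    using xs(2) by (simp add: c conjugate_mset_def[of "mset _"] rev_sort_partition[OF p]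
        conjugate_conjugate[OF xs(1)])
  show "size (conjugate_mset M) = Max (insert 0 (set_mset M))"
    using part_1_eq_Max[OF xs(1)] xs(2) unfolding c by (metis length_conjugate set_mset_mset size_mset)
qed

section \<open>Splitting a partition into pairs of equal parts and a set of leftovers\<close>

definition pair_decompositions :: "nat \<Rightarrow> (nat multiset \<times> nat set) set" where
  "pair_decompositions n =
    {(M, D). 0 \<notin># M \<and> finite D \<and> 0 \<notin> D \<and> 2 * sum_mset M + \<Sum>D = n}"

definition halve_mset :: "nat multiset \<Rightarrow> nat multiset" where
  "halve_mset N = Abs_multiset (\<lambda>x. count N x div 2)"

lemma count_halve_mset: "count (halve_mset N) x = count N x div 2"
proof -
  have "finite {x. 0 < count N x div 2}"
    by (rule finite_subset[of _ "set_mset N"]) (auto intro: count_inI)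
  then show ?thesis by (simp add: halve_mset_def count_Abs_multiset)
qed

lemma sum_mset_mset_set: "finite D \<Longrightarrow> sum_mset (mset_set D) = \<Sum>D"
  using sum_unfold_sum_mset[of "\<lambda>x. x" D] by simp

lemma halve_mset_double:
  "halve_mset N + halve_mset N + mset_set {x. odd (count N x)} = N"
proof -
  have fin: "finite {x. odd (count N x)}"
    by (rule finite_subset[of _ "set_mset N"]) (auto intro: count_inI elim: oddE)
  show ?thesis
    by (rule multiset_eqI) (simp add: count_halve_mset count_mset_set' fin, presburger)
qed

text \<open>Division by 2 with remainder, applied to every multiplicity: the quotients form M and
  the remainders are the indicator function of D.\<close>

lemma bij_betw_pair_decompositions:
  "bij_betw (\<lambda>N. (halve_mset N, {x. odd (count N x)}))
     {N. 0 \<notin># N \<and> sum_mset N = n} (pair_decompositions n)"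
proof (rule bij_betw_byWitness[where f' = "\<lambda>(M, D). M + M + mset_set D"])
  have fin: "finite {x. odd (count N x)}" for N :: "nat multiset"
    by (rule finite_subset[of _ "set_mset N"]) (auto intro: count_inI elim: oddE)
  show "(\<lambda>N. (halve_mset N, {x. odd (count N x)})) ` {N. 0 \<notin># N \<and> sum_mset N = n}
      \<subseteq> pair_decompositions n"
  proof clarify
    fix N :: "nat multiset" assume N: "0 \<notin># N" "n = sum_mset N"
    have "sum_mset N = sum_mset (halve_mset N + halve_mset N + mset_set {x. odd (count N x)})"
      by (simp only: halve_mset_double)
    also have "\<dots> = 2 * sum_mset (halve_mset N) + \<Sum>{x. odd (count N x)}"
      using fin[of N] by (simp add: sum_mset_mset_set)
    finally show "(halve_mset N, {x. odd (count N x)}) \<in> pair_decompositions (sum_mset N)"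
      using N fin[of N]
      by (simp add: pair_decompositions_def not_in_iff count_halve_mset)
  qed
  show "(\<lambda>(M, D). M + M + mset_set D) ` pair_decompositions n \<subseteq> {N. 0 \<notin># N \<and> sum_mset N = n}"
    by (auto simp: pair_decompositions_def sum_mset_mset_set)
  show "\<forall>p\<in>pair_decompositions n. (\<lambda>N. (halve_mset N, {x. odd (count N x)}))
      (case p of (M, D) \<Rightarrow> M + M + mset_set D) = p"
    by (auto simp: pair_decompositions_def count_mset_set' split: if_splits
        intro!: multiset_eqI simp: count_halve_mset)
qed (simp add: halve_mset_double)

lemma finite_pair_decompositions: "finite (pair_decompositions n)"
  using finite_partitions_of[of n] bij_betw_finite[OF bij_betw_mset_partitions[of n]]
    bij_betw_finite[OF bij_betw_pair_decompositions[of n]] by simp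

text \<open>A multiplicity is at least 2 exactly when its half, rounded down, is positive.\<close>

lemma largest_repeated_eq_Max:
  "largest_repeated xs = Max (insert 0 (set_mset (halve_mset (mset xs))))"
proof -
  have "{p \<in> set xs. count_list xs p \<ge> 2} = set_mset (halve_mset (mset xs))"
    by (auto simp: set_mset_def count_halve_mset count_mset simp flip: count_greater_zero_iff
        intro: ccontr)
  then show ?thesis by (simp add: largest_repeated_def)
qed

section \<open>Parity of the alternating sum\<close>

lemma even_alternating_sum:
  "even (\<Sum>i<n. (-1) ^ i * f i :: int) \<longleftrightarrow> even (\<Sum>i<n. f i)"
  by (induction n) auto

text \<open>Signs do not affect parity, and the parts of odd multiplicity sum to n minus twice the
  weight of the halved multiset.\<close>

lemma even_alternating_odd_sum:
  assumes "xs \<in> partitions_of n"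
  shows "even (alternating_odd_sum xs) \<longleftrightarrow> even n"
proof -
  let ?D = "{x. odd (count (mset xs) x)}"
  have D: "{p \<in> set xs. odd (count_list xs p)} = ?D"
    by (auto simp: count_mset intro: ccontr)
  have fin: "finite ?D"
    by (rule finite_subset[of _ "set xs"]) (auto intro: ccontr simp: count_mset)
  have "even (alternating_odd_sum xs) \<longleftrightarrow> even (\<Sum>i<length (odd_mult_parts xs). int (odd_mult_parts xs ! i))"
    unfolding alternating_odd_sum_def by (rule even_alternating_sum)
  also have "(\<Sum>i<length (odd_mult_parts xs). int (odd_mult_parts xs ! i)) = int (sum_list (odd_mult_parts xs))"
    by (simp add: sum_list_sum_nth atLeast0LessThan)
  also have "sum_list (odd_mult_parts xs) = \<Sum>?D"
    unfolding odd_mult_parts_def D sum_list_rev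
    using sum.distinct_set_conv_list[of "sorted_list_of_set ?D" "\<lambda>x. x"] fin by simp
  also have "(halve_mset (mset xs), ?D) \<in> pair_decompositions n"
    using bij_betw_apply[OF bij_betw_pair_decompositions, of "mset xs" n]
      bij_betw_apply[OF bij_betw_mset_partitions assms] by simp
  then have "even (int (\<Sum>?D)) \<longleftrightarrow> even n"
    by (auto simp: pair_decompositions_def simp del: of_nat_sum)
  finally show ?thesis .
qed

section \<open>The sign-reversing involution\<close>

(* The halves of the even parts of 2M + D; the pair p is (M, D). *)
definition even_halves :: "nat multiset \<times> nat set \<Rightarrow> nat set" where
  "even_halves p = set_mset (fst p) \<union> {x. 2 * x \<in> snd p}"

text \<open>Membership in D is tested first because the set D cannot take a second copy of 2m,
  whereas the multiset M can always take another m.\<close>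

definition move_even :: "nat multiset \<times> nat set \<Rightarrow> nat multiset \<times> nat set" where
  "move_even p = (let m = Max (even_halves p) in
    if 2 * m \<in> snd p then (add_mset m (fst p), snd p - {2 * m})
    else (fst p - {#m#}, insert (2 * m) (snd p)))"

lemma finite_even_halves:
  assumes "p \<in> pair_decompositions n"
  shows "finite (even_halves p)"
proof -
  obtain M D where p: "p = (M, D)" by force
  have "{x. 2 * x \<in> D} \<subseteq> (\<lambda>x. x div 2) ` D" by force
  then show ?thesis
    using assms by (auto simp: p even_halves_def pair_decompositions_def intro: finite_subset)
qed

text \<open>Either move keeps m among the halves and changes no other half. Hence the maximum is the
  same the second time, and the test on 2m, now with the opposite outcome, undoes the move. The sign
  flips because M gains or loses one element.\<close>

lemma move_even:
  assumes p: "p \<in> pair_decompositions n" and ne: "even_halves p \<noteq> {}"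
  shows "move_even p \<in> pair_decompositions n" "even_halves (move_even p) = even_halves p"
    "move_even (move_even p) = p" "(-1 :: int) ^ size (fst (move_even p)) = - ((-1) ^ size (fst p))"
proof -
  obtain M D where MD: "p = (M, D)" by force
  define m where "m = Max (even_halves (M, D))"
  have m: "m \<in> even_halves (M, D)" unfolding m_def
    by (rule Max_in[OF finite_even_halves[OF p, unfolded MD] ne[unfolded MD]])
  have pd: "0 \<notin># M" "finite D" "0 \<notin> D" "2 * sum_mset M + \<Sum>D = n"
    using p by (auto simp: MD pair_decompositions_def)
  have m0: "m \<noteq> 0"
    by (rule notI) (use m pd in \<open>simp add: even_halves_def\<close>)
  have "move_even (M, D) \<in> pair_decompositions n \<and> even_halves (move_even (M, D)) = even_halves (M, D) \<and>
    move_even (move_even (M, D)) = (M, D) \<and> (-1 :: int) ^ size (fst (move_even (M, D))) = - ((-1) ^ size (fst (M, D)))"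
  proof (cases "2 * m \<in> D")
    case True
    have mv: "move_even (M, D) = (add_mset m M, D - {2 * m})"
      using True by (simp add: move_even_def Let_def flip: m_def)
    have eh: "even_halves (move_even (M, D)) = even_halves (M, D)"
      using True by (auto simp: mv even_halves_def)
    have "\<Sum>D = 2 * m + \<Sum>(D - {2 * m})"
      using sum.remove[OF pd(2) True, of "\<lambda>x. x"] by simp
    then have "move_even (M, D) \<in> pair_decompositions n"
      using pd m0 by (simp add: mv pair_decompositions_def)
    moreover have "move_even (move_even (M, D)) = (M, D)"
      using eh True by (simp add: mv move_even_def[of "(add_mset m M, D - {2 * m})"] m_def[symmetric] Let_def insert_absorb)
    ultimately show ?thesis using eh by (simp add: mv)
  next
    case False
    then have mM: "m \<in># M" using m by (auto simp: even_halves_def)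
    then obtain M' where M': "M = add_mset m M'" by (metis mset_add)
    have mv: "move_even (M, D) = (M', insert (2 * m) D)"
      using False by (simp add: move_even_def Let_def flip: m_def) (simp add: M')
    have eh: "even_halves (move_even (M, D)) = even_halves (M, D)"
      unfolding mv by (auto simp: even_halves_def M')
    have "move_even (M, D) \<in> pair_decompositions n"
      using pd m0 False unfolding mv by (simp add: pair_decompositions_def M')
    moreover have "move_even (move_even (M, D)) = (M, D)"
      using eh False by (simp add: mv move_even_def[of "(M', insert (2 * m) D)"] m_def[symmetric] Let_def) (simp add: M')
    ultimately show ?thesis using eh unfolding mv by (simp add: M')
  qed
  then show "move_even p \<in> pair_decompositions n" "even_halves (move_even p) = even_halves p"
    "move_even (move_even p) = p" "(-1 :: int) ^ size (fst (move_even p)) = - ((-1) ^ size (fst p))"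
    by (simp_all only: MD)
qed

lemma signed_count_pair_decompositions:
  "(\<Sum>(M, D)\<in>pair_decompositions n. (-1 :: int) ^ size M) =
    int (card {D. finite D \<and> (\<forall>h\<in>D. odd h) \<and> \<Sum>D = n})"
proof -
  let ?P = "pair_decompositions n"
  let ?E = "{p \<in> ?P. even_halves p = {}}"
  let ?F = "{p \<in> ?P. even_halves p \<noteq> {}}"
  let ?f = "\<lambda>p :: nat multiset \<times> nat set. (-1 :: int) ^ size (fst p)"
  \<comment> \<open>Reindexing by the involution shows that the sum over \<open>?F\<close> equals
    its own negative.\<close>
  have "sum ?f ?F = (\<Sum>p\<in>?F. - ?f p)"
    by (rule sum.reindex_bij_witness[of _ move_even move_even]) (simp_all add: move_even[of _ n])
  then have "sum ?f ?F = 0" by (simp add: sum_negf)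
  moreover have "?P = ?E \<union> ?F" by auto
  then have "sum ?f ?P = sum ?f ?E + sum ?f ?F"
    by (metis (no_types, lifting) finite_pair_decompositions finite_Un sum.union_disjoint
        disjoint_iff mem_Collect_eq)
  \<comment> \<open>Without even parts, M is empty and D consists of odd numbers, so each remaining
    pair has sign +1.\<close>
  moreover have "?E = Pair {#} ` {D. finite D \<and> (\<forall>h\<in>D. odd h) \<and> \<Sum>D = n}"
  proof -
    have "(\<forall>x. 2 * x \<notin> D) \<longleftrightarrow> (\<forall>h\<in>D. odd h)" for D :: "nat set"
      by (auto elim: evenE)
    then have *: "even_halves (M, D) = {} \<longleftrightarrow> M = {#} \<and> (\<forall>h\<in>D. odd h)" for M D
      by (simp add: even_halves_def)
    show ?thesis
    proof (intro equalityI subsetI)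
      fix p assume p: "p \<in> ?E"
      obtain M D where MD: "p = (M, D)" by force
      have "M = {#}" "\<forall>h\<in>D. odd h" using p * unfolding MD by blast+
      moreover have "finite D" "2 * sum_mset M + \<Sum>D = n"
        using p unfolding MD pair_decompositions_def by blast+
      ultimately show "p \<in> Pair {#} ` {D. finite D \<and> (\<forall>h\<in>D. odd h) \<and> \<Sum>D = n}"
        by (simp add: MD)
    next
      fix p :: "nat multiset \<times> nat set" assume "p \<in> Pair {#} ` {D. finite D \<and> (\<forall>h\<in>D. odd h) \<and> \<Sum>D = n}"
      then obtain D where D: "p = ({#}, D)" "finite D" "\<forall>h\<in>D. odd h" "\<Sum>D = n" by blast
      then have "0 \<notin> D" by (metis even_zero)
      then show "p \<in> ?E" using D * by (simp add: pair_decompositions_def)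
    qed
  qed
  then have "sum ?f ?E = int (card {D. finite D \<and> (\<forall>h\<in>D. odd h) \<and> \<Sum>D = n})"
    by (simp add: sum.reindex inj_on_def)
  ultimately show ?thesis by (simp add: case_prod_beta)
qed

lemma signed_count_largest_repeated:
  "(\<Sum>xs\<in>partitions_of n. (-1 :: int) ^ largest_repeated xs) =
    int (card {D. finite D \<and> (\<forall>h\<in>D. odd h) \<and> \<Sum>D = n})"
proof -
  let ?g = "\<lambda>N. (halve_mset N, {x. odd (count N x)})"
  have "bij_betw (?g \<circ> mset) (partitions_of n) (pair_decompositions n)"
    using bij_betw_trans[OF bij_betw_mset_partitions bij_betw_pair_decompositions] .
  from sum.reindex_bij_betw[OF this, of "\<lambda>(M, D). (-1 :: int) ^ Max (insert 0 (set_mset M))"]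
  have "(\<Sum>xs\<in>partitions_of n. (-1 :: int) ^ largest_repeated xs) =
      (\<Sum>(M, D)\<in>pair_decompositions n. (-1) ^ Max (insert 0 (set_mset M)))"
    by (simp add: largest_repeated_eq_Max)
  \<comment> \<open>Conjugating M alone preserves its weight and turns its largest part into its
    size.\<close>
  also have "\<dots> = (\<Sum>(M, D)\<in>pair_decompositions n. (-1) ^ size M)"
    by (rule sum.reindex_bij_witness[of _ "map_prod conjugate_mset id" "map_prod conjugate_mset id"])
      (auto simp: pair_decompositions_def conjugate_mset)
  finally show ?thesis by (simp add: signed_count_pair_decompositions)
qed

theorem corollary4p4:
  "(\<forall>xs. is_partition xs \<longrightarrow> (kappa xs = 0 \<longleftrightarrow> conjugate xs = xs)) \<and>
   (\<forall>n. int (card {xs \<in> partitions_of n. even (pairing_rank xs)})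
        - int (card {xs \<in> partitions_of n. odd (pairing_rank xs)})
        = (-1) ^ n * int (card {xs \<in> partitions_of n. kappa xs = 0}))"
proof (intro conjI allI impI)
  fix n
  let ?P = "partitions_of n"
  have sign: "(if even (pairing_rank xs) then 1 else -1) = (-1 :: int) ^ n * (-1) ^ largest_repeated xs"
    if "xs \<in> ?P" for xs
    using even_alternating_odd_sum[OF that] by (simp add: pairing_rank_def minus_one_power_iff)
  \<comment> \<open>The difference of the two counts is the sum of the signs of the pairing ranks,
    to which \<open>sign\<close> then applies termwise.\<close>
  have "int (card {xs \<in> ?P. even (pairing_rank xs)}) - int (card {xs \<in> ?P. odd (pairing_rank xs)})
      = (\<Sum>xs\<in>?P. if even (pairing_rank xs) then 1 else -1)"
    using finite_partitions_of[of n] by (simp add: sum.If_cases Int_def)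
  also have "\<dots> = (-1) ^ n * (\<Sum>xs\<in>?P. (-1) ^ largest_repeated xs)"
    by (simp add: sign sum_distrib_left cong: sum.cong)
  also have "\<dots> = (-1) ^ n * int (card {xs \<in> ?P. conjugate xs = xs})"
    by (simp add: signed_count_largest_repeated card_self_conjugate_partitions)
  also have "{xs \<in> ?P. conjugate xs = xs} = {xs \<in> ?P. kappa xs = 0}"
    using kappa_eq_0_iff_self_conjugate by (auto simp: partitions_of_def)
  finally show "int (card {xs \<in> ?P. even (pairing_rank xs)})
      - int (card {xs \<in> ?P. odd (pairing_rank xs)})
      = (-1) ^ n * int (card {xs \<in> ?P. kappa xs = 0})" .
qed (rule kappa_eq_0_iff_self_conjugate)

end
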